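(* Assume that for every odd integer $q\ge 3$ there is a real number $R_q<2$ such that $\mathrm{res}_q(N,N')\le R_q$ for every positive integer $N$ and every $N'$ reached from $N$ by a non-repeating $q$-Collatz process. Let $q\ge 3$ be an odd integer, let $N$ be a positive integer, and let $N'$ be reached from $N$ by a non-repeating $q$-Collatz process with $d$ steps in total, of which $o$ are odd steps and $e$ are even steps. Then $$\begin{aligned} o&=\lfloor \log_{2q}(2)\, d-\log_{2q}(N/N')\rfloor,\\ e&=\lceil \log_{2q}(q)\, d+\log_{2q}(N/N')\rceil,\\ d&=\lceil \log_2(2q)\, o+\log_2(N/N')\rceil,\\ e&=\lceil \log_2(q)\, o+\log_2(N/N')\rceil,\\ d&=\lfloor \log_q(2q)\, e-\log_q(N/N')\rfloor,\\ o&=\lfloor \log_q(2)\, e-\log_q(N/N')\rfloor. \end{aligned}$$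
   Context: For an odd integer $q\ge 3$, the $q$-Collatz function on integers is $C_q(N)=qN+1$ if $N$ is odd and $C_q(N)=N/2$ if $N$ is even. A non-repeating $q$-Collatz process from $N$ to $N'$ with $d$ steps means $N'=C_q^{(d)}(N)$ for some integer $d\ge 0$, where the values $N,C_q(N),\dots,C_q^{(d)}(N)=N'$ are pairwise distinct. An odd step is an application of $C_q$ to an odd integer, an even step an application to an even integer; $o$ and $e$ denote the numbers of odd and even steps, so $d=o+e$. The residue is $\mathrm{res}_q(N,N')=\dfrac{2^{e}}{q^{o}\cdot \frac{N}{N'}}$. *)

theory Defs
  imports Complex_Main
begin

definition collatz :: "int \<Rightarrow> int \<Rightarrow> int" where
  "collatz q N = (if odd N then q * N + 1 else N div 2)"

definition nonrepeating_process :: "int \<Rightarrow> int \<Rightarrow> int \<Rightarrow> nat \<Rightarrow> bool" where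
  "nonrepeating_process q N N' d \<longleftrightarrow>
     N' = (collatz q ^^ d) N \<and> inj_on (\<lambda>i. (collatz q ^^ i) N) {0..d}"

definition odd_steps :: "int \<Rightarrow> int \<Rightarrow> nat \<Rightarrow> nat" where
  "odd_steps q N d = card {i. i < d \<and> odd ((collatz q ^^ i) N)}"

definition even_steps :: "int \<Rightarrow> int \<Rightarrow> nat \<Rightarrow> nat" where
  "even_steps q N d = card {i. i < d \<and> even ((collatz q ^^ i) N)}"

lemma nonrepeating_process_unique:
  assumes "nonrepeating_process q N N' d" "nonrepeating_process q N N' d'"
  shows "d = d'"
proof -
  have le: "b \<le> a" if "nonrepeating_process q N N' a" "nonrepeating_process q N N' b" for a b
  proof (rule ccontr)
    assume "\<not> b \<le> a"
    hence "a \<in> {0..b}" "b \<in> {0..b}" "a \<noteq> b" by auto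
    with that show False unfolding nonrepeating_process_def inj_on_def by metis
  qed
  show ?thesis using le[OF assms] le[OF assms(2,1)] by simp
qed

(* By the preceding lemma the number of steps, hence also the numbers of odd and
   even steps, is determined by the endpoints of a non-repeating process.  The value
   is meaningful only if N' is reached from N by such a process. *)
definition residue :: "int \<Rightarrow> int \<Rightarrow> int \<Rightarrow> real" where
  "residue q N N' =
     (let d = (THE d. nonrepeating_process q N N' d)
      in 2 ^ even_steps q N d / (of_int q ^ odd_steps q N d * (of_int N / of_int N')))"

end

theory Submission
  imports Defs
begin

text \<open>
  Dropping the \<open>+1\<close> in every odd step shows that the residue is at least \<open>1\<close>; the hypothesis
  says it is less than \<open>2\<close>. Taking logarithms of
  \<open>q ^ o * (N / N') \<le> 2 ^ e < 2 * q ^ o * (N / N')\<close> gives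
  \<open>o * ln q + ln (N / N') \<le> e * ln 2 < o * ln q + ln (N / N') + ln 2\<close>, and since \<open>ln 2 \<le> ln q\<close>
  and \<open>d = o + e\<close>, all six formulas are rearrangements of these two inequalities.
\<close>

text \<open>Positivity of every iterate is what later makes \<open>N / N'\<close> positive, so that
  its logarithm is meaningful.\<close>

lemma funpow_collatz_pos:
  assumes "q > 0" "N > 0"
  shows "(collatz q ^^ d) N > 0"
proof (induction d)
  case (Suc d)
  have "collatz q M > 0" if "M > 0" for M
    using that assms(1) by (auto simp: collatz_def add_pos_pos elim!: evenE)
  with Suc show ?case by simp
qed (use assms in simp)

lemma Collect_less_Suc_conj:
  "{i. i < Suc d \<and> P i} = (if P d then insert d {i. i < d \<and> P i} else {i. i < d \<and> P i})"
  by (auto simp: less_Suc_eq)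

lemma odd_steps_0: "odd_steps q N 0 = 0"
  by (simp add: odd_steps_def)

lemma even_steps_0: "even_steps q N 0 = 0"
  by (simp add: even_steps_def)

lemma odd_steps_Suc:
  "odd_steps q N (Suc d) = odd_steps q N d + (if odd ((collatz q ^^ d) N) then 1 else 0)"
  unfolding odd_steps_def Collect_less_Suc_conj by simp

lemma even_steps_Suc:
  "even_steps q N (Suc d) = even_steps q N d + (if even ((collatz q ^^ d) N) then 1 else 0)"
  unfolding even_steps_def Collect_less_Suc_conj by simp

lemma odd_steps_plus_even_steps: "odd_steps q N d + even_steps q N d = d"
  by (induction d) (auto simp: odd_steps_0 even_steps_0 odd_steps_Suc even_steps_Suc)

text \<open>Induction on the steps: an even step is an exact halving, and an odd step exceeds
  multiplication by \<open>q\<close> by 1, so the inequality survives both. The product form keeps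
  everything in the integers.\<close>

lemma power_odd_steps_le:
  assumes "q \<ge> 0"
  shows "q ^ odd_steps q N d * N \<le> 2 ^ even_steps q N d * (collatz q ^^ d) N"
proof (induction d)
  case 0
  then show ?case by (simp add: odd_steps_0 even_steps_0)
next
  case (Suc d)
  define M where "M = (collatz q ^^ d) N"
  show ?case
  proof (cases "odd M")
    case True
    have "q * (q ^ odd_steps q N d * N) \<le> q * (2 ^ even_steps q N d * M)"
      using Suc assms unfolding M_def by (rule mult_left_mono)
    \<comment> \<open>The only loss in the estimate: the two sides differ by exactly
      \<open>2 ^ even_steps q N d\<close>, the contribution of the summand 1.\<close>
    also have "\<dots> \<le> 2 ^ even_steps q N d * (q * M + 1)"
      by (simp add: algebra_simps)
    also have "q * M + 1 = collatz q M"
      using True by (simp add: collatz_def)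
    finally show ?thesis
      using True by (simp add: odd_steps_Suc even_steps_Suc mult_ac flip: M_def)
  next
    case False
    then have "2 * collatz q M = M" by (simp add: collatz_def)
    then have "2 ^ even_steps q N d * M = 2 ^ even_steps q N (Suc d) * collatz q M"
      using False by (simp add: even_steps_Suc flip: M_def)
    with Suc False show ?thesis
      by (simp add: odd_steps_Suc flip: M_def)
  qed
qed

text \<open>The endpoints determine the number of steps, so the definite description in
  \<open>residue\<close> denotes the given \<open>d\<close>.\<close>

lemma residue_eq:
  assumes "nonrepeating_process q N N' d"
  shows "residue q N N' =
    2 ^ even_steps q N d / (of_int q ^ odd_steps q N d * (of_int N / of_int N'))"
proof -
  have "(THE d. nonrepeating_process q N N' d) = d"
    using assms nonrepeating_process_unique by blast
  then show ?thesis by (simp add: residue_def)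
qed

lemma residue_ge_1:
  assumes "q > 0" "N > 0" "nonrepeating_process q N N' d"
  shows "residue q N N' \<ge> 1"
proof -
  have N': "N' = (collatz q ^^ d) N"
    using assms(3) by (simp add: nonrepeating_process_def)
  then have "N' > 0" using funpow_collatz_pos assms(1,2) by simp
  have "real_of_int (q ^ odd_steps q N d * N) \<le> real_of_int (2 ^ even_steps q N d * N')"
    unfolding N' of_int_le_iff using power_odd_steps_le assms(1) by simp
  then show ?thesis
    unfolding residue_eq[OF assms(3)] using \<open>N' > 0\<close> assms(1,2) by (simp add: field_simps)
qed

text \<open>Put \<open>t = k * a - m * b - c\<close> with \<open>a\<close>, \<open>b\<close>,
  \<open>c\<close> as in the proof; the hypotheses say \<open>0 \<le> t < a\<close>. In each formula
  the real number differs from the integer by \<open>t / D\<close>, upwards for floors and downwards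
  for ceilings, where \<open>D\<close> is \<open>a + b\<close>, \<open>a\<close> or \<open>b\<close>
  for base \<open>2 * q\<close>, \<open>2\<close> or \<open>q\<close>. As \<open>a \<le> D\<close>,
  the difference lies in \<open>[0, 1)\<close>.\<close>

lemma log_floor_ceiling_formulas:
  fixes q x :: real and m k :: nat
  assumes "q \<ge> 2" "x > 0"
    and le: "q ^ m * x \<le> 2 ^ k" and less: "2 ^ k < 2 * (q ^ m * x)"
  shows
    "int m = \<lfloor>log (2 * q) 2 * real (m + k) - log (2 * q) x\<rfloor>"
    "int k = \<lceil>log (2 * q) q * real (m + k) + log (2 * q) x\<rceil>"
    "int (m + k) = \<lceil>log 2 (2 * q) * real m + log 2 x\<rceil>"
    "int k = \<lceil>log 2 q * real m + log 2 x\<rceil>"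
    "int (m + k) = \<lfloor>log q (2 * q) * real k - log q x\<rfloor>"
    "int m = \<lfloor>log q 2 * real k - log q x\<rfloor>"
proof -
  define a b c where "a = ln (2::real)" and "b = ln q" and "c = ln x"
  \<comment> \<open>The bound \<open>a \<le> b\<close>, from \<open>q \<ge> 2\<close>, keeps the
    error below 1 in base \<open>q\<close>.\<close>
  have ab: "0 < a" "a \<le> b" "0 < b" "0 < a + b"
    using assms(1) by (auto simp: a_def b_def intro: add_pos_pos)
  have ln_2q: "ln (2 * q) = a + b"
    using assms(1) by (simp add: a_def b_def ln_mult)
  have "ln (q ^ m * x) \<le> ln (2 ^ k)"
    using le assms(1,2) by (subst ln_le_cancel_iff) auto
  then have L: "m * b + c \<le> k * a"
    using assms(1,2) by (simp add: a_def b_def c_def ln_mult ln_realpow)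
  have "ln (2 ^ k) < ln (2 * (q ^ m * x))"
    using less assms(1,2) by (subst ln_less_cancel_iff) auto
  then have U: "k * a < a + m * b + c"
    using assms(1,2) by (simp add: a_def b_def c_def ln_mult ln_realpow)
  \<comment> \<open>These rewrites merge each argument into one fraction over the logarithm of the
    base; clearing it leaves linear consequences of \<open>L\<close> and \<open>U\<close>.\<close>
  note defs = log_def ln_2q a_def[symmetric] b_def[symmetric] c_def[symmetric]
    times_divide_eq_left diff_divide_distrib[symmetric] add_divide_distrib[symmetric]
  note facts = ab L U
  show "int m = \<lfloor>log (2 * q) 2 * real (m + k) - log (2 * q) x\<rfloor>"
    unfolding defs using facts by (intro floor_unique[symmetric]) (simp_all add: field_simps)
  show "int k = \<lceil>log (2 * q) q * real (m + k) + log (2 * q) x\<rceil>"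
    unfolding defs using facts by (intro ceiling_unique[symmetric]) (simp_all add: field_simps)
  show "int (m + k) = \<lceil>log 2 (2 * q) * real m + log 2 x\<rceil>"
    unfolding defs using facts by (intro ceiling_unique[symmetric]) (simp_all add: field_simps)
  show "int k = \<lceil>log 2 q * real m + log 2 x\<rceil>"
    unfolding defs using facts by (intro ceiling_unique[symmetric]) (simp_all add: field_simps)
  show "int (m + k) = \<lfloor>log q (2 * q) * real k - log q x\<rfloor>"
    unfolding defs using facts by (intro floor_unique[symmetric]) (simp_all add: field_simps)
  show "int m = \<lfloor>log q 2 * real k - log q x\<rfloor>"
    unfolding defs using facts by (intro floor_unique[symmetric]) (simp_all add: field_simps)
qed

theorem theorem5p11:
  fixes q N N' :: int and d n_odd n_even :: nat
  assumes residue_bound: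
      "\<forall>p::int. odd p \<and> p \<ge> 3 \<longrightarrow>
         (\<exists>R::real. R < 2 \<and>
           (\<forall>M M'. M > 0 \<and> (\<exists>k. nonrepeating_process p M M' k) \<longrightarrow> residue p M M' \<le> R))"
    and "odd q" and "q \<ge> 3" and "N > 0"
    and "nonrepeating_process q N N' d"
    and "n_odd = odd_steps q N d" and "n_even = even_steps q N d"
  shows
    "int n_odd = \<lfloor>log (2 * real_of_int q) 2 * real d
        - log (2 * real_of_int q) (real_of_int N / real_of_int N')\<rfloor> \<and>
     int n_even = \<lceil>log (2 * real_of_int q) (real_of_int q) * real d
        + log (2 * real_of_int q) (real_of_int N / real_of_int N')\<rceil> \<and>
     int d = \<lceil>log 2 (2 * real_of_int q) * real n_odd
        + log 2 (real_of_int N / real_of_int N')\<rceil> \<and>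
     int n_even = \<lceil>log 2 (real_of_int q) * real n_odd
        + log 2 (real_of_int N / real_of_int N')\<rceil> \<and>
     int d = \<lfloor>log (real_of_int q) (2 * real_of_int q) * real n_even
        - log (real_of_int q) (real_of_int N / real_of_int N')\<rfloor> \<and>
     int n_odd = \<lfloor>log (real_of_int q) 2 * real n_even
        - log (real_of_int q) (real_of_int N / real_of_int N')\<rfloor>"
proof -
  let ?q = "real_of_int q" and ?x = "real_of_int N / real_of_int N'"
  have "N' > 0"
    using assms(3-5) funpow_collatz_pos[of q N d] by (simp add: nonrepeating_process_def)
  then have x: "?x > 0" using \<open>N > 0\<close> by simp
  have q: "?q \<ge> 2" using \<open>q \<ge> 3\<close> by simp
  have pos: "?q ^ n_odd * ?x > 0" using q x by (intro mult_pos_pos) auto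
  have res: "residue q N N' = 2 ^ n_even / (?q ^ n_odd * ?x)"
    using residue_eq[OF assms(5)] assms(6,7) by simp
  have "residue q N N' \<ge> 1"
    using residue_ge_1 assms(3-5) by simp
  then have le: "?q ^ n_odd * ?x \<le> 2 ^ n_even"
    unfolding res using pos by (simp only: le_divide_eq_1_pos)
  \<comment> \<open>The assumed bound is used at \<open>q\<close>, \<open>N\<close>,
    \<open>N'\<close>; its strictness gives the open end of the interval for the rounding
    error.\<close>
  have "residue q N N' < 2"
    using residue_bound assms(2-5) by (meson order_le_less_trans)
  then have less: "2 ^ n_even < 2 * (?q ^ n_odd * ?x)"
    unfolding res using pos by (simp only: pos_divide_less_eq)
  have d: "d = n_odd + n_even"
    using odd_steps_plus_even_steps assms(6,7) by simp
  show ?thesis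
    unfolding d using log_floor_ceiling_formulas[OF q x le less] by blast
qed

end
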